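(* Let $p$ be a prime, and let $K=\{k_1,k_2,\ldots,k_r\}$ and $L=\{l_1,l_2,\ldots,l_s\}$ be two disjoint subsets of $\{0,1,\ldots,p-1\}$ (with $r=|K|\ge1$, $s=|L|$). Let $\mathcal{A}=\{A_1,\ldots,A_m\}$ be a family of distinct subsets of $[n]$ such that $|A_i|\pmod p\in K$ for every $i$ and $|A_i\cap A_j|\pmod p\in L$ for every $i\ne j$. If $n\ge 2s-2r+1$, then \[ |\mathcal{A}|\le \binom{n-1}{s}+\binom{n-1}{s-1}+\cdots+\binom{n-1}{s-2r+1}. \]
   Context: Binomial coefficients $\binom{a}{b}$ with $b<0$ are interpreted as $0$. *)

theory Defs
  imports "HOL-Computational_Algebra.Primes"
begin

definition ibinom :: "nat \<Rightarrow> int \<Rightarrow> nat" where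
  "ibinom a b = (if b < 0 then 0 else a choose (nat b))"

end

theory Submission
  imports Defs "HOL-Library.FuncSet"
begin

text \<open>
  Fix the point \<open>n\<close> and write \<open>N = n - 1\<close>, \<open>r = |K|\<close>, \<open>s = |L|\<close>. Consider multilinear polynomials modulo \<open>p\<close> in
  the indicator variables of the other \<open>N\<close> points. To a member \<open>A\<close> of the family attach
  \<open>f\<^sub>A(X) = \<Prod>\<^bsub>l\<in>L\<^esub> (|X \<inter> A| + [n \<in> A] - l)\<close>, and to a set \<open>I\<close> of at most \<open>s - 2r\<close> points attach
  \<open>g\<^sub>I(X) = [I \<subseteq> X] \<Prod>\<^bsub>k\<in>K\<^esub> (|X| - k)(|X| - k + 1)\<close>. All have degree at most \<open>s\<close>. Every \<open>g\<^sub>I\<close> vanishes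
  at every \<open>C - {n}\<close> with \<open>C\<close> in the family. The matrix of values \<open>f\<^sub>A(C - {n})\<close> is block triangular with nonzero
  diagonal if the sets containing \<open>n\<close> come first. So the \<open>f\<^sub>A\<close> and \<open>g\<^sub>I\<close> together are
  independent as soon as the \<open>g\<^sub>I\<close> are, and counting dimensions gives the bound.

  The leading form of a combination of the \<open>g\<^sub>I\<close> of top degree \<open>a = |I|\<close> is obtained by
  multiplying its part of degree \<open>a\<close> by the \<open>2r\<close>-th power of the sum of the variables, where squares of variables
  are set to zero. This multiplication by an \<open>m\<close>-th power is injective modulo \<open>p\<close> in degree \<open>a\<close>
  whenever \<open>2a + m \<le> N\<close> and \<open>a + m < p\<close>; here \<open>n \<ge> 2s - 2r + 1\<close> enters.
\<close>

section \<open>Independence modulo \<open>p\<close> by counting vectors\<close>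

text \<open>Comparing the numbers \<open>p ^ card E\<close> and \<open>p ^ card B\<close> of vectors modulo \<open>p\<close> replaces linear algebra
  over the field with \<open>p\<close> elements.\<close>

lemma card_le_if_independent_mod:
  fixes u :: "'e \<Rightarrow> 'b \<Rightarrow> int" and p :: nat
  assumes "p > 1" "finite E" "finite B"
    and indep: "\<And>c e. (\<forall>b\<in>B. int p dvd (\<Sum>e\<in>E. c e * u e b)) \<Longrightarrow> e \<in> E \<Longrightarrow> int p dvd c e"
  shows "card E \<le> card B"
proof -
  let ?R = "{0..<int p}"
  define \<Phi> where "\<Phi> c = (\<lambda>b\<in>B. (\<Sum>e\<in>E. c e * u e b) mod int p)" for c
  have "inj_on \<Phi> (E \<rightarrow>\<^sub>E ?R)"
  proof (rule inj_onI)
    fix c d assume c: "c \<in> E \<rightarrow>\<^sub>E ?R" and d: "d \<in> E \<rightarrow>\<^sub>E ?R" and eq: "\<Phi> c = \<Phi> d"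
    have "int p dvd (\<Sum>e\<in>E. (c e - d e) * u e b)" if "b \<in> B" for b
    proof -
      have "(\<Sum>e\<in>E. c e * u e b) mod int p = (\<Sum>e\<in>E. d e * u e b) mod int p"
        using fun_cong[OF eq, of b] that by (simp add: \<Phi>_def)
      then have "int p dvd (\<Sum>e\<in>E. c e * u e b) - (\<Sum>e\<in>E. d e * u e b)"
        by (simp add: mod_eq_dvd_iff)
      then show ?thesis by (simp add: left_diff_distrib sum_subtractf)
    qed
    then have dvd: "int p dvd c e - d e" if "e \<in> E" for e
      using indep[of "\<lambda>e. c e - d e"] that by blast
    show "c = d"
    proof (rule PiE_ext[OF c d])
      fix e assume e: "e \<in> E"
      have "c e \<in> ?R" "d e \<in> ?R" using c d e by auto
      moreover have "c e mod int p = d e mod int p"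
        using dvd[OF e] by (simp add: mod_eq_dvd_iff)
      ultimately show "c e = d e" by simp
    qed
  qed
  moreover have "\<Phi> ` (E \<rightarrow>\<^sub>E ?R) \<subseteq> B \<rightarrow>\<^sub>E ?R"
    using \<open>p > 1\<close> by (auto simp: \<Phi>_def)
  moreover have "finite (B \<rightarrow>\<^sub>E ?R)" using \<open>finite B\<close> by (intro finite_PiE) auto
  ultimately have "card (E \<rightarrow>\<^sub>E ?R) \<le> card (B \<rightarrow>\<^sub>E ?R)" by (rule card_inj_on_le)
  then have "p ^ card E \<le> p ^ card B" using assms(2,3) by (simp add: card_PiE)
  then show ?thesis using \<open>p > 1\<close> by simp
qed

section \<open>Multilinear polynomials as coefficient functions\<close>

text \<open>A function \<open>c\<close> on sets stands for the multilinear polynomial with coefficient \<open>c J\<close> at the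
  monomial \<open>\<Prod>\<^bsub>i\<in>J\<^esub> x\<^sub>i\<close>. The operator \<open>mult_affine A t\<close> multiplies by \<open>(\<Sum>\<^bsub>i\<in>A\<^esub> x\<^sub>i) - t\<close> modulo
  \<open>x\<^sub>i\<^sup>2 = x\<^sub>i\<close>, and \<open>raise\<close> multiplies by \<open>\<Sum>\<^sub>i x\<^sub>i\<close> modulo \<open>x\<^sub>i\<^sup>2 = 0\<close>.\<close>

definition multilinear_eval :: "('a set \<Rightarrow> int) \<Rightarrow> 'a set \<Rightarrow> int" where
  "multilinear_eval c X = (\<Sum>J\<in>Pow X. c J)"

definition mult_affine :: "'a set \<Rightarrow> int \<Rightarrow> ('a set \<Rightarrow> int) \<Rightarrow> 'a set \<Rightarrow> int" where
  "mult_affine A t c J = (int (card (J \<inter> A)) - t) * c J + (\<Sum>i\<in>J \<inter> A. c (J - {i}))"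

definition raise :: "('a set \<Rightarrow> int) \<Rightarrow> 'a set \<Rightarrow> int" where
  "raise c J = (\<Sum>i\<in>J. c (J - {i}))"

lemma raise_pow_Suc: "(raise ^^ Suc m) c J = (\<Sum>i\<in>J. (raise ^^ m) c (J - {i}))"
  by (simp add: raise_def[of "(raise ^^ m) c"])

text \<open>After the substitution \<open>I = J - {i}\<close>, each \<open>c I\<close> occurs once
  for every \<open>i\<close> in \<open>(X - I) \<inter> A\<close>, which complements the count over
  \<open>I \<inter> A\<close>.\<close>

lemma multilinear_eval_mult_affine:
  assumes "finite X"
  shows "multilinear_eval (mult_affine A t c) X = (int (card (X \<inter> A)) - t) * multilinear_eval c X"
proof -
  have "(\<Sum>J\<in>Pow X. \<Sum>i\<in>J \<inter> A. c (J - {i}))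
      = (\<Sum>(J,i)\<in>Sigma (Pow X) (\<lambda>J. J \<inter> A). c (J - {i}))"
    using assms by (subst sum.Sigma) (auto intro: finite_subset)
  also have "\<dots> = (\<Sum>(I,i)\<in>Sigma (Pow X) (\<lambda>I. (X - I) \<inter> A). c I)"
    by (rule sum.reindex_bij_witness[where i = "\<lambda>(I,i). (insert i I, i)" and j = "\<lambda>(J,i). (J - {i}, i)"])
       auto
  also have "\<dots> = (\<Sum>I\<in>Pow X. \<Sum>i\<in>(X - I) \<inter> A. c I)"
    using assms by (subst sum.Sigma) auto
  finally have shift: "(\<Sum>J\<in>Pow X. \<Sum>i\<in>J \<inter> A. c (J - {i}))
      = (\<Sum>I\<in>Pow X. int (card ((X - I) \<inter> A)) * c I)" by simp
  have split: "int (card (J \<inter> A)) + int (card ((X - J) \<inter> A)) = int (card (X \<inter> A))"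
    if "J \<in> Pow X" for J
  proof -
    have "X \<inter> A = (J \<inter> A) \<union> ((X - J) \<inter> A)" using that by auto
    moreover have "finite J" using that assms by (auto intro: finite_subset)
    ultimately have "card (X \<inter> A) = card (J \<inter> A) + card ((X - J) \<inter> A)"
      using assms card_Un_disjoint[of "J \<inter> A" "(X - J) \<inter> A"] by auto
    then show ?thesis by simp
  qed
  have "multilinear_eval (mult_affine A t c) X
      = (\<Sum>J\<in>Pow X. (int (card (J \<inter> A)) - t) * c J + int (card ((X - J) \<inter> A)) * c J)"
    by (simp add: multilinear_eval_def mult_affine_def sum.distrib shift)
  also have "\<dots> = (\<Sum>J\<in>Pow X. (int (card (X \<inter> A)) - t) * c J)"
    by (rule sum.cong[OF refl]) (simp add: split[symmetric] algebra_simps)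
  finally show ?thesis by (simp add: multilinear_eval_def sum_distrib_left)
qed

lemma multilinear_eval_fold_mult_affine:
  assumes "finite X"
  shows "multilinear_eval (fold (mult_affine A) ts c) X
    = (\<Prod>t\<leftarrow>ts. int (card (X \<inter> A)) - t) * multilinear_eval c X"
  by (induction ts arbitrary: c) (simp_all add: multilinear_eval_mult_affine assms)

lemma multilinear_eval_sum:
  "multilinear_eval (\<lambda>J. \<Sum>e\<in>E. c e * u e J) X = (\<Sum>e\<in>E. c e * multilinear_eval (u e) X)"
  unfolding multilinear_eval_def by (subst sum.swap) (simp add: sum_distrib_left)

lemma dvd_multilinear_coeff:
  assumes "finite V" and "\<And>X. X \<subseteq> V \<Longrightarrow> q dvd multilinear_eval c X" and "J \<subseteq> V"
  shows "q dvd c J"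
  using finite_subset[OF assms(3,1)] assms(3)
proof (induction J rule: finite_psubset_induct)
  case (psubset J)
  have "multilinear_eval c J = c J + (\<Sum>I\<in>Pow J - {J}. c I)"
    using psubset(1) by (simp add: multilinear_eval_def sum.remove[of "Pow J" J])
  moreover have "q dvd (\<Sum>I\<in>Pow J - {J}. c I)"
    using psubset by (intro dvd_sum) auto
  ultimately show ?case using assms(2)[OF psubset(3)] by (simp add: dvd_add_left_iff)
qed

lemma mult_affine_sum:
  "mult_affine A t (\<lambda>J. \<Sum>e\<in>E. c e * u e J) = (\<lambda>J. \<Sum>e\<in>E. c e * mult_affine A t (u e) J)"
proof
  fix J
  have "(\<Sum>i\<in>J \<inter> A. \<Sum>e\<in>E. c e * u e (J - {i})) = (\<Sum>e\<in>E. c e * (\<Sum>i\<in>J \<inter> A. u e (J - {i})))"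
    by (subst sum.swap) (simp add: sum_distrib_left)
  then show "mult_affine A t (\<lambda>J. \<Sum>e\<in>E. c e * u e J) J = (\<Sum>e\<in>E. c e * mult_affine A t (u e) J)"
    by (simp add: mult_affine_def sum.distrib sum_distrib_left distrib_left mult.left_commute)
qed

lemma fold_mult_affine_sum:
  "fold (mult_affine A) ts (\<lambda>J. \<Sum>e\<in>E. c e * u e J)
    = (\<lambda>J. \<Sum>e\<in>E. c e * fold (mult_affine A) ts (u e) J)"
  by (induction ts arbitrary: u) (simp_all add: mult_affine_sum)

section \<open>Degrees and leading forms\<close>

lemma dvd_mult_affine_above:
  assumes "\<And>J. finite J \<Longrightarrow> card J > a \<Longrightarrow> q dvd c J" "finite J" "card J > Suc a"
  shows "q dvd mult_affine A t c J"
  unfolding mult_affine_def using assms by (intro dvd_add dvd_mult dvd_sum) auto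

lemma dvd_fold_mult_affine_above:
  assumes "\<And>J. finite J \<Longrightarrow> card J > a \<Longrightarrow> q dvd c J" "finite J" "card J > a + length ts"
  shows "q dvd fold (mult_affine A) ts c J"
  using assms
proof (induction ts arbitrary: c a)
  case (Cons t ts)
  show ?case
    using Cons.IH[of "Suc a" "mult_affine A t c"] Cons.prems dvd_mult_affine_above[of a q c]
    by simp
qed simp

lemma fold_mult_affine_degree:
  assumes "\<And>J. finite J \<Longrightarrow> card J > a \<Longrightarrow> c J = 0" "finite J" "card J > a + length ts"
  shows "fold (mult_affine A) ts c J = 0"
  \<comment> \<open>Divisibility by \<open>0\<close> means being \<open>0\<close>.\<close>
  using dvd_fold_mult_affine_above[of a 0 c J ts A] assms by simp

lemma dvd_diff_raise_pow:
  assumes "\<And>J. J \<subseteq> V \<Longrightarrow> card J = a \<Longrightarrow> q dvd c J - d J" "finite V" "J \<subseteq> V" "card J = a + m"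
  shows "q dvd (raise ^^ m) c J - (raise ^^ m) d J"
  using assms(3,4)
proof (induction m arbitrary: J)
  case (Suc m)
  have "q dvd (\<Sum>i\<in>J. (raise ^^ m) c (J - {i}) - (raise ^^ m) d (J - {i}))"
    using Suc.prems finite_subset[OF _ assms(2)] by (intro dvd_sum Suc.IH) auto
  then show ?case by (simp only: raise_pow_Suc sum_subtractf)
qed (use assms(1) in simp)

lemma dvd_raise_pow:
  assumes "\<And>J. J \<subseteq> V \<Longrightarrow> card J = a \<Longrightarrow> q dvd c J" "finite V" "J \<subseteq> V" "card J = a + m"
  shows "q dvd (raise ^^ m) c J"
  using assms(3,4)
proof (induction m arbitrary: J)
  case (Suc m)
  have "q dvd (\<Sum>i\<in>J. (raise ^^ m) c (J - {i}))"
    using Suc.prems finite_subset[OF _ assms(2)] by (intro dvd_sum Suc.IH) auto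
  then show ?case by (simp only: raise_pow_Suc)
qed (use assms(1) in simp)

text \<open>The constants \<open>t\<close> and the reductions of squares do not raise the degree, so
  in top degree only \<open>raise\<close> is visible.\<close>

lemma fold_mult_affine_leading:
  assumes "\<And>J. finite J \<Longrightarrow> card J > a \<Longrightarrow> q dvd c J" "finite V" "J \<subseteq> V" "card J = a + length ts"
  shows "q dvd fold (mult_affine V) ts c J - (raise ^^ length ts) c J"
  using assms(1,4)
proof (induction ts arbitrary: c a)
  case (Cons t ts)
  let ?c = "mult_affine V t c"
  have "q dvd fold (mult_affine V) ts ?c J - (raise ^^ length ts) ?c J"
    using Cons.prems dvd_mult_affine_above[of a q c] by (intro Cons.IH[of "Suc a"]) auto
  moreover have "q dvd (raise ^^ length ts) ?c J - (raise ^^ length ts) (raise c) J"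
  proof (rule dvd_diff_raise_pow[where V = V and a = "Suc a"])
    fix I assume I: "I \<subseteq> V" "card I = Suc a"
    then have "I \<inter> V = I" "finite I" using finite_subset[OF _ assms(2)] by auto
    then show "q dvd ?c I - raise c I"
      using Cons.prems(1)[of I] I by (simp add: mult_affine_def raise_def)
  qed (use assms(2,3) Cons.prems in auto)
  ultimately have "q dvd fold (mult_affine V) ts ?c J - (raise ^^ length ts) (raise c) J"
    using dvd_add by fastforce
  then show ?case by (simp add: funpow_swap1)
qed simp

section \<open>Injectivity of multiplication by powers of the sum of the variables\<close>

lemma raise_pow_small: "finite J \<Longrightarrow> card J < m \<Longrightarrow> (raise ^^ m) c J = 0"
proof (induction m arbitrary: J)
  case (Suc m)
  have "card (J - {i}) < m" if "i \<in> J" for i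
    using card_Diff1_less[of J i] Suc.prems that by linarith
  then show ?case
    unfolding raise_pow_Suc using Suc.prems(1) by (intro sum.neutral ballI Suc.IH) auto
qed simp

text \<open>With \<open>x_v^2 = 0\<close> this is \<open>(e + x_v)^m = e^m + m x_v e^(m-1)\<close>,
  where \<open>e\<close> is the sum of the other variables.\<close>

lemma raise_pow_insert:
  assumes "finite J" "v \<notin> J"
  shows "(raise ^^ m) c (insert v J)
    = int m * (raise ^^ (m - 1)) c J + (raise ^^ m) (\<lambda>J. c (insert v J)) J"
  using assms
proof (induction m arbitrary: J)
  case (Suc m)
  let ?d = "\<lambda>J. c (insert v J)"
  have "(raise ^^ Suc m) c (insert v J)
      = (raise ^^ m) c J + (\<Sum>i\<in>J. (raise ^^ m) c (insert v (J - {i})))"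
  proof -
    have "(\<Sum>i\<in>J. (raise ^^ m) c (insert v J - {i})) = (\<Sum>i\<in>J. (raise ^^ m) c (insert v (J - {i})))"
      using Suc.prems by (intro sum.cong) (auto intro!: arg_cong[where f = "(raise ^^ m) c"])
    then show ?thesis using Suc.prems by (simp add: raise_pow_Suc del: funpow.simps)
  qed
  also have "(\<Sum>i\<in>J. (raise ^^ m) c (insert v (J - {i})))
      = (\<Sum>i\<in>J. int m * (raise ^^ (m - 1)) c (J - {i}) + (raise ^^ m) ?d (J - {i}))"
    using Suc.prems by (intro sum.cong refl Suc.IH) auto
  also have "\<dots> = int m * raise ((raise ^^ (m - 1)) c) J + (raise ^^ Suc m) ?d J"
    by (simp only: raise_pow_Suc raise_def[of "(raise ^^ (m - 1)) c"] sum.distrib sum_distrib_left)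
  also have "int m * raise ((raise ^^ (m - 1)) c) J = int m * (raise ^^ m) c J"
    by (cases m) auto
  finally show ?case by (simp add: algebra_simps)
qed simp

text \<open>Write \<open>c = c\<^sub>0 + x\<^sub>v c\<^sub>1\<close> and \<open>e\<close> for the sum of the variables other than \<open>x\<^sub>v\<close>. The hypothesis says
  \<open>e\<^sup>m c\<^sub>0 = 0\<close> and \<open>m e\<^bsup>m-1\<^esup> c\<^sub>0 + e\<^sup>m c\<^sub>1 = 0\<close>. Multiplying the latter by \<open>e\<close> gives \<open>e\<^bsup>m+1\<^esup> c\<^sub>1 = 0\<close>,
  so \<open>c\<^sub>1 = 0\<close> by induction, and then \<open>e\<^bsup>m-1\<^esup> c\<^sub>0 = 0\<close> because \<open>m\<close> is invertible.\<close>

lemma raise_pow_inj_mod: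
  fixes p :: nat
  assumes "prime p" "finite V" "2 * a + m \<le> card V" "a + m < p"
    and "\<And>J. J \<subseteq> V \<Longrightarrow> card J = a + m \<Longrightarrow> int p dvd (raise ^^ m) c J"
    and "I \<subseteq> V" "card I = a"
  shows "int p dvd c I"
  using assms(2-)
proof (induction V arbitrary: a m c I rule: finite_induct)
  case empty
  then show ?case by (metis Nat.add_0_right add_is_0 card.empty funpow_0 le_zero_eq)
next
  case (insert v W)
  show ?case
  proof (cases m)
    case 0
    then show ?thesis using insert.prems by simp
  next
    case (Suc m')
    have cardW: "card (insert v W) = Suc (card W)" using insert.hyps by simp
    have fin: "finite J" if "J \<subseteq> W" for J using that insert.hyps(1) by (rule finite_subset)
    have vJ: "v \<notin> J" if "J \<subseteq> W" for J using that insert.hyps(2) by auto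
    let ?d = "\<lambda>J. c (insert v J)"
    have sum_dvd: "int p dvd int m * (raise ^^ m') c J + (raise ^^ m) ?d J"
      if "J \<subseteq> W" "card J = a + m'" for J
      using insert.prems(3)[of "insert v J"] raise_pow_insert[of J v m c] that fin[of J] vJ[of J] Suc
      by (simp add: subset_insertI2)
    have d0: "int p dvd ?d I" if I: "I \<subseteq> W" "Suc (card I) = a" for I
    proof (rule insert.IH[of "card I" "Suc m" ?d])
      \<comment> \<open>Going from \<open>(a, m)\<close> to \<open>(a - 1, m + 1)\<close> lowers
        \<open>2 * a + m\<close> by one and keeps \<open>a + m\<close>, so both bounds survive the
        loss of \<open>v\<close>.\<close>
      show "2 * card I + Suc m \<le> card W" "card I + Suc m < p"
        using insert.prems(1,2) I cardW by auto
      fix J assume J: "J \<subseteq> W" "card J = card I + Suc m"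
      have "int p dvd (\<Sum>i\<in>J. int m * (raise ^^ m') c (J - {i}) + (raise ^^ m) ?d (J - {i}))"
        using J I Suc fin[of J] by (intro dvd_sum sum_dvd) auto
      then have "int p dvd int m * (raise ^^ m) c J + (raise ^^ Suc m) ?d J"
        by (simp only: raise_pow_Suc[of m] raise_pow_Suc[of m' c J, folded Suc] sum.distrib sum_distrib_left)
      moreover have "int p dvd (raise ^^ m) c J" using insert.prems(3)[of J] J I by auto
      ultimately show "int p dvd (raise ^^ Suc m) ?d J"
        by (meson dvd_add_right_iff dvd_mult)
    qed (use I in auto)
    have c0: "int p dvd c I" if I: "I \<subseteq> W" "card I = a" for I
    proof (rule insert.IH[of a m' c])
      show "2 * a + m' \<le> card W" "a + m' < p"
        using insert.prems(1,2) cardW Suc by auto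
      fix J assume J: "J \<subseteq> W" "card J = a + m'"
      have "int p dvd (raise ^^ m) ?d J"
      proof (cases a)
        case 0
        then show ?thesis using raise_pow_small[of J m ?d] J Suc fin[of J] by simp
      next
        case (Suc a')
        then show ?thesis
          using d0 J \<open>m = Suc m'\<close> insert.hyps(1) by (intro dvd_raise_pow[where V = W and a = a']) auto
      qed
      then have "int p dvd int m * (raise ^^ m') c J"
        using sum_dvd[OF J] by (simp add: dvd_add_left_iff)
      moreover have "\<not> int p dvd int m"
        using insert.prems(2) Suc nat_dvd_not_less[of m p] by (simp only: of_nat_dvd_iff) simp
      ultimately show "int p dvd (raise ^^ m') c J"
        using assms(1) by (simp add: prime_dvd_mult_iff)
    qed (use I in auto)
    show ?thesis
    proof (cases "v \<in> I")
      case True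
      have "I - {v} \<subseteq> W" using insert.prems(4) by auto
      moreover have "Suc (card (I - {v})) = a"
        using True insert.prems(4,5) insert.hyps(1) by (metis card_Suc_Diff1 finite.insertI finite_subset)
      ultimately show ?thesis using d0[of "I - {v}"] True by (simp add: insert_absorb)
    next
      case False
      then show ?thesis using c0 insert.prems(4,5) by auto
    qed
  qed
qed

text \<open>Downward induction on the degree \<open>k\<close>: once the coefficients above
  \<open>k\<close> vanish modulo \<open>p\<close>, the leading form of the product determines those
  in degree \<open>k\<close>.\<close>

lemma symmetric_multiple_inj_mod:
  fixes p :: nat
  assumes "prime p" "finite V" and size: "2 * a + length ts \<le> card V" "a + length ts < p"
    and supp: "\<And>J. \<not> (J \<subseteq> V \<and> card J \<le> a) \<Longrightarrow> d J = 0"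
    and zero: "\<And>J. J \<subseteq> V \<Longrightarrow> int p dvd fold (mult_affine V) ts d J"
  shows "int p dvd d I"
proof -
  have "\<forall>I. card I \<ge> k \<longrightarrow> int p dvd d I" for k
  proof (induction "Suc a - k" arbitrary: k)
    case 0
    then show ?case using supp by auto
  next
    case (Suc x)
    have above: "int p dvd d J" if "card J > k" for J
      using Suc.hyps(1)[of "Suc k"] Suc.hyps(2) that by auto
    have "int p dvd d I" if I: "card I = k" for I
    proof (cases "I \<subseteq> V")
      case True
      have "int p dvd (raise ^^ length ts) d J" if J: "J \<subseteq> V" "card J = k + length ts" for J
        using fold_mult_affine_leading[of k "int p" d V J ts] zero[of J] above J assms(2)
          dvd_diff_right_iff by blast
      then show ?thesis
        using raise_pow_inj_mod[OF assms(1,2), of k "length ts" d I] True I size Suc.hyps(2) by simp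
    next
      case False
      then show ?thesis using supp by auto
    qed
    then show ?case using above by (metis le_neq_implies_less)
  qed
  from this[of 0] show ?thesis by simp
qed


section \<open>Counts and congruences\<close>

lemma card_subsets_by_card:
  assumes "finite V" "finite N"
  shows "card {J. J \<subseteq> V \<and> card J \<in> N} = (\<Sum>j\<in>N. card V choose j)"
proof -
  have "{J. J \<subseteq> V \<and> card J \<in> N} = (\<Union>j\<in>N. {J. J \<subseteq> V \<and> card J = j})" by auto
  also have "card \<dots> = (\<Sum>j\<in>N. card {J. J \<subseteq> V \<and> card J = j})"
    using assms by (intro card_UN_disjoint) auto
  finally show ?thesis using assms by (simp add: n_subsets)
qed

lemma sum_ibinom:
  "(\<Sum>i<m. ibinom N (int s - int i)) = (\<Sum>j | j \<le> s \<and> s < j + m. N choose j)"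
proof -
  have "(\<Sum>i<m. ibinom N (int s - int i)) = (\<Sum>i\<in>{i. i < m \<and> i \<le> s}. ibinom N (int s - int i))"
    by (rule sum.mono_neutral_right) (auto simp: ibinom_def)
  also have "\<dots> = (\<Sum>j | j \<le> s \<and> s < j + m. N choose j)"
    by (rule sum.reindex_bij_witness[where i = "\<lambda>j. s - j" and j = "\<lambda>i. s - i"])
       (auto simp: ibinom_def nat_diff_distrib)
  finally show ?thesis .
qed

lemma prime_dvd_prod_list_int:
  fixes p :: nat and xs :: "int list"
  assumes "prime p"
  shows "int p dvd prod_list xs \<longleftrightarrow> (\<exists>x\<in>set xs. int p dvd x)"
  using assms prime_gt_1_nat[OF assms] by (induction xs) (auto simp: prime_dvd_mult_iff)

lemma int_dvd_diff_iff_mod: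
  "l < p \<Longrightarrow> int p dvd int x - int l \<longleftrightarrow> x mod p = l"
  by (metis mod_eq_dvd_iff mod_less of_nat_eq_iff of_nat_mod)

section \<open>Set families with restricted sizes and intersections modulo \<open>p\<close>\<close>

theorem theorem2p11:
  fixes p n :: nat and K L :: "nat set" and F :: "nat set set"
  assumes "prime p"
    and "K \<subseteq> {0..<p}" and "L \<subseteq> {0..<p}" and "K \<inter> L = {}" and "card K \<ge> 1"
    and "F \<subseteq> Pow {1..n}"
    and "\<forall>A\<in>F. card A mod p \<in> K"
    and "\<forall>A\<in>F. \<forall>B\<in>F. A \<noteq> B \<longrightarrow> card (A \<inter> B) mod p \<in> L"
    and "int n \<ge> 2 * int (card L) - 2 * int (card K) + 1"
  shows "card F \<le> (\<Sum>i<2 * card K. ibinom (n - 1) (int (card L) - int i))"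
proof -
  define V where "V = {1..<n}"
  define r s where "r = card K" and "s = card L"
  \<comment> \<open>The form with \<open>+\<close> makes \<open>S\<close> empty for
    \<open>s < 2 * r\<close>, unlike truncated subtraction.\<close>
  define S where "S = {I. I \<subseteq> V \<and> card I + 2 * r \<le> s}"
  define B where "B = {J. J \<subseteq> V \<and> card J \<le> s}"
  have finV: "finite V" and cardV: "card V = n - 1" by (simp_all add: V_def)
  have finS: "finite S" and finB: "finite B"
    using finV by (auto simp: S_def B_def intro: finite_subset[of _ "Pow V"])
  have finF: "finite F" using assms(6) by (rule finite_subset) simp
  have finK: "finite K" and finL: "finite L"
    using assms(2,3) finite_subset by blast+
  \<comment> \<open>As \<open>r \<ge> 1\<close>, this gives \<open>s < p\<close>, the bound for
    injectivity into degree \<open>(s - 2 * r) + 2 * r\<close>.\<close>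
  have sp: "s + r \<le> p"
    using card_mono[of "{0..<p}" "K \<union> L"] assms(2-4) finK finL
    by (simp add: card_Un_disjoint r_def s_def)
  have nV: "2 * s \<le> card V + 2 * r" using assms(9) by (simp add: cardV r_def s_def)

  define \<delta> :: "nat set \<Rightarrow> int" where "\<delta> A = of_bool (n \<in> A)" for A
  define ls where "ls A = map (\<lambda>l. int l - \<delta> A) (sorted_list_of_set L)" for A
  \<comment> \<open>For \<open>C\<close> in \<open>F\<close>, the size of \<open>C - {n}\<close> is
    congruent to some \<open>k\<close> in \<open>K\<close> or to \<open>k - 1\<close>.\<close>
  define ks where "ks = map int (sorted_list_of_set K) @ map (\<lambda>k. int k - 1) (sorted_list_of_set K)"
  define f where "f A X = (\<Prod>t\<leftarrow>ls A. int (card (X \<inter> A)) - t)" for A X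
  define g where "g X = (\<Prod>t\<leftarrow>ks. int (card (X \<inter> V)) - t)" for X
  define mono :: "nat set \<Rightarrow> nat set \<Rightarrow> int" where "mono I J = of_bool (J = I)" for I J
  define u where "u e = (case e of Inl A \<Rightarrow> fold (mult_affine A) (ls A) (mono {})
      | Inr I \<Rightarrow> fold (mult_affine V) ks (mono I))" for e
  have len_ls: "length (ls A) = s" for A by (simp add: ls_def s_def)
  have len_ks: "length ks = 2 * r" by (simp add: ks_def r_def)

  have f_dvd_iff: "int p dvd f A X \<longleftrightarrow> (\<exists>l\<in>L. int p dvd int (card (X \<inter> A)) + \<delta> A - int l)" for A X
    unfolding f_def prime_dvd_prod_list_int[OF assms(1)]
    using finL by (auto simp: ls_def algebra_simps)
  \<comment> \<open>If \<open>n\<close> lies in both sets, \<open>\<delta> A\<close> restores the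
    point lost in \<open>C - {n}\<close>.\<close>
  have f_dvd_iff': "int p dvd f A (C - {n}) \<longleftrightarrow> card (A \<inter> C) mod p \<in> L"
    if "A \<in> F" "C \<in> F" "n \<in> A \<longrightarrow> n \<in> C" for A C
  proof -
    have "finite (A \<inter> C)" using that(1) assms(6) by (auto intro: finite_subset)
    then have "int (card ((C - {n}) \<inter> A)) + \<delta> A = int (card (A \<inter> C))"
    proof (cases "n \<in> A")
      case True
      have "(C - {n}) \<inter> A = A \<inter> C - {n}" by auto
      then show ?thesis
        using True that(3) \<open>finite (A \<inter> C)\<close> card_Suc_Diff1[of "A \<inter> C" n] by (simp add: \<delta>_def)
    next
      case False
      then have "(C - {n}) \<inter> A = A \<inter> C" by auto
      then show ?thesis using False by (simp add: \<delta>_def)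
    qed
    moreover have "l < p" if "l \<in> L" for l using assms(3) that by auto
    ultimately show ?thesis
      unfolding f_dvd_iff by (auto simp: int_dvd_diff_iff_mod)
  qed
  have g_dvd: "int p dvd g (C - {n})" if "C \<in> F" for C
  proof -
    define k where "k = card C mod p"
    have k: "k \<in> K" using assms(7) that by (simp add: k_def)
    then have "k < p" using assms(2) by auto
    then have pk: "int p dvd int (card C) - int k" by (simp add: int_dvd_diff_iff_mod k_def)
    have C: "C \<subseteq> {1..n}" using assms(6) that by auto
    then have "finite C" by (rule finite_subset) simp
    have "(C - {n}) \<inter> V = C - {n}" using C by (auto simp: V_def)
    moreover have "int (card (C - {n})) = int (card C) - \<delta> C"
      using card_Suc_Diff1[of C n] \<open>finite C\<close> by (cases "n \<in> C") (auto simp: \<delta>_def)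
    ultimately have "int p dvd int (card ((C - {n}) \<inter> V)) - (int k - \<delta> C)" using pk by simp
    moreover have "int k - \<delta> C \<in> set ks"
      using k finK by (auto simp: ks_def \<delta>_def of_bool_def)
    ultimately show ?thesis
      unfolding g_def prime_dvd_prod_list_int[OF assms(1)] set_map by blast
  qed

  have "card (F <+> S) \<le> card B"
  proof (rule card_le_if_independent_mod[where u = u and p = p])
    show "p > 1" using assms(1) by (rule prime_gt_1_nat)
    show "finite (F <+> S)" "finite B" using finF finS finB by auto
    fix c e assume zero: "\<forall>J\<in>B. int p dvd (\<Sum>e\<in>F <+> S. c e * u e J)" and e: "e \<in> F <+> S"
    define tot where "tot J = (\<Sum>e\<in>F <+> S. c e * u e J)" for J
    define d where "d J = (\<Sum>I\<in>S. c (Inr I) * mono I J)" for J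
    have tot: "tot J = (\<Sum>A\<in>F. c (Inl A) * u (Inl A) J) + fold (mult_affine V) ks d J" for J
      unfolding tot_def d_def[abs_def] fold_mult_affine_sum
      using finF finS by (simp add: sum.Plus u_def)
    \<comment> \<open>This degree bound extends the vanishing modulo \<open>p\<close> from
      \<open>B\<close> to all subsets of \<open>V\<close>.\<close>
    have "u e J = 0" if "J \<subseteq> V" "card J > s" "e \<in> F <+> S" for e J
    proof -
      have "finite J" using that(1) finV by (rule finite_subset)
      show ?thesis
      proof (cases e)
        case (Inl A)
        then show ?thesis
          using \<open>finite J\<close> that
          by (auto simp: u_def mono_def len_ls intro!: fold_mult_affine_degree[where a = 0])
      next
        case (Inr I)
        then show ?thesis
          using \<open>finite J\<close> that
          by (auto simp: u_def mono_def len_ks S_def intro!: fold_mult_affine_degree[where a = "s - 2 * r"])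
      qed
    qed
    then have tot_dvd: "int p dvd tot J" if "J \<subseteq> V" for J
      using zero that by (cases "card J \<le> s") (auto simp: tot_def B_def)
    have eval_f: "multilinear_eval (u (Inl A)) X = f A X" if "finite X" for A X
    proof -
      have "multilinear_eval (mono {}) X = 1"
        using that by (simp add: multilinear_eval_def mono_def of_bool_def)
      then show ?thesis using that by (simp add: u_def multilinear_eval_fold_mult_affine f_def)
    qed
    have eval_tot: "multilinear_eval tot X = (\<Sum>A\<in>F. c (Inl A) * f A X) + g X * multilinear_eval d X"
      if "finite X" for X
    proof -
      have "multilinear_eval tot X = (\<Sum>A\<in>F. c (Inl A) * multilinear_eval (u (Inl A)) X)
          + multilinear_eval (fold (mult_affine V) ks d) X"
        unfolding multilinear_eval_sum[symmetric]
        by (simp add: tot multilinear_eval_def sum.distrib)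
      then show ?thesis using that by (simp add: eval_f multilinear_eval_fold_mult_affine g_def)
    qed
    \<comment> \<open>For \<open>n \<in> C\<close> the premise \<open>ind\<close> is vacuous, so the
      members containing \<open>n\<close> are settled first and then supply \<open>ind\<close> for
      the others.\<close>
    have step: "int p dvd c (Inl C)"
      if C: "C \<in> F" and ind: "\<And>A. A \<in> F \<Longrightarrow> n \<in> A \<Longrightarrow> n \<notin> C \<Longrightarrow> int p dvd c (Inl A)" for C
    proof -
      have X: "C - {n} \<subseteq> V" using C assms(6) by (fastforce simp: V_def)
      then have fin: "finite (C - {n})" using finV by (rule finite_subset)
      have "int p dvd multilinear_eval tot (C - {n})"
        unfolding multilinear_eval_def using X by (intro dvd_sum tot_dvd) auto
      then have "int p dvd (\<Sum>A\<in>F. c (Inl A) * f A (C - {n}))"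
        using eval_tot[OF fin] g_dvd[OF C] by (simp add: dvd_add_left_iff)
      moreover have "int p dvd (\<Sum>A\<in>F - {C}. c (Inl A) * f A (C - {n}))"
      proof (rule dvd_sum)
        fix A assume A: "A \<in> F - {C}"
        show "int p dvd c (Inl A) * f A (C - {n})"
        proof (cases "n \<in> A \<longrightarrow> n \<in> C")
          case True
          then show ?thesis using f_dvd_iff'[of A C] A C assms(8) by auto
        next
          case False
          then show ?thesis using ind A by auto
        qed
      qed
      ultimately have "int p dvd c (Inl C) * f C (C - {n})"
        using C finF by (simp add: sum.remove[of F C] dvd_add_left_iff)
      moreover have "\<not> int p dvd f C (C - {n})"
        using f_dvd_iff'[OF C C] assms(4,7) C by auto
      ultimately show ?thesis using assms(1) by (simp add: prime_dvd_mult_iff)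
    qed
    have cF: "int p dvd c (Inl C)" if "C \<in> F" for C
      using step[OF that] step by blast
    show "int p dvd c e"
    proof (cases e)
      case (Inl C)
      then show ?thesis using cF e by auto
    next
      case (Inr I)
      then have I: "I \<in> S" using e by auto
      then have "2 * r \<le> s" by (simp add: S_def)
      have d: "d J = (if J \<in> S then c (Inr J) else 0)" for J
        using finS by (simp add: d_def mono_def of_bool_def if_distrib cong: if_cong)
      have "int p dvd d I"
      proof (rule symmetric_multiple_inj_mod[OF assms(1) finV, of "s - 2 * r" ks])
        show "2 * (s - 2 * r) + length ks \<le> card V"
          using nV \<open>2 * r \<le> s\<close> by (simp add: len_ks)
        show "s - 2 * r + length ks < p"
          using sp assms(5) \<open>2 * r \<le> s\<close> by (simp add: len_ks r_def)
        show "d J = 0" if "\<not> (J \<subseteq> V \<and> card J \<le> s - 2 * r)" for J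
          using that \<open>2 * r \<le> s\<close> by (auto simp: d S_def)
        show "int p dvd fold (mult_affine V) ks d J" if "J \<subseteq> V" for J
        proof -
          have "int p dvd (\<Sum>A\<in>F. c (Inl A) * u (Inl A) J)"
            by (intro dvd_sum dvd_mult2 cF)
          then show ?thesis using tot_dvd[OF that] by (simp add: tot dvd_add_right_iff)
        qed
      qed
      then show ?thesis using Inr I d by simp
    qed
  qed
  then have "card F + card S \<le> card B" using finF finS by (simp add: card_Plus)
  moreover have "S \<subseteq> B" by (auto simp: S_def B_def)
  then have "card (B - S) = card B - card S" using finS by (intro card_Diff_subset)
  moreover have "B - S = {J. J \<subseteq> V \<and> card J \<in> {j. j \<le> s \<and> s < j + 2 * r}}"
    by (auto simp: S_def B_def)
  then have "card (B - S) = (\<Sum>j | j \<le> s \<and> s < j + 2 * r. (n - 1) choose j)"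
    using card_subsets_by_card[OF finV, of "{j. j \<le> s \<and> s < j + 2 * r}"] cardV by simp
  ultimately show ?thesis by (simp add: sum_ibinom r_def s_def)
qed

end
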